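(* Let $p$ be a prime and $G$ a finite abelian group of order $p^2$. Then there exists no (nontrivial) $(p^2,m,k,\lambda)$-SEDF in $G$ with $m>2$.
   Context: A $(v,m,k,\lambda)$-SEDF (strong external difference family) in a finite abelian group $G$ of order $v$ (written multiplicatively) is a collection $\{D_1,\dots,D_m\}$ of mutually disjoint $k$-subsets of $G$ such that for each $1\le j\le m$ and each non-identity $g\in G$, the number of pairs $(x,y)$ with $x\in D_j$, $y\in\bigcup_{i\ne j}D_i$, $xy^{-1}=g$ equals $\lambda$ (with $\lambda\ge1$). Nontrivial means $k>1$. *)

theory Defs
  imports
    "HOL-Algebra.Coset"
    "HOL-Library.Disjoint_Sets"
    "HOL-Computational_Algebra.Primes"
begin

(* The family is indexed by {1..m}; l is the parameter usually written lambda. *)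
definition SEDF ::
  "('a, 'b) monoid_scheme \<Rightarrow> nat \<Rightarrow> nat \<Rightarrow> nat \<Rightarrow> nat \<Rightarrow> (nat \<Rightarrow> 'a set) \<Rightarrow> bool"
  where "SEDF G v m k l D \<longleftrightarrow>
    comm_group G \<and> finite (carrier G) \<and> order G = v \<and>
    (\<forall>j\<in>{1..m}. D j \<subseteq> carrier G \<and> card (D j) = k) \<and>
    disjoint_family_on D {1..m} \<and>
    l \<ge> 1 \<and>
    (\<forall>j\<in>{1..m}. \<forall>g\<in>carrier G - {\<one>\<^bsub>G\<^esub>}.
      card {(x, y). x \<in> D j \<and> y \<in> (\<Union>i\<in>{1..m} - {j}. D i) \<and> x \<otimes>\<^bsub>G\<^esub> inv\<^bsub>G\<^esub> y = g} = l)"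

end

theory Submission
  imports Defs "Jordan_Normal_Form.Char_Poly" "HOL-Number_Theory.Residues"
begin

text \<open>Let $D$ be the union of the $D_j$. Counting gives $p \nmid k$, so $km \neq p^2$ and
  $D \neq G$; hence some nontrivial character $\chi$ has $\chi(D) \neq 0$. The SEDF equation reads
  $\chi(D_j)\overline{(\chi(D) - \chi(D_j))} = -\lambda$, so each $\chi(D_j)\overline{\chi(D)}$ is real
  and is a root of one fixed quadratic equation. Since these numbers add up to $|\chi(D)|^2$ and
  $m > 2$, both roots occur and the two values $A > B > 0$ of $|\chi(D_j)|^2$ are rational with
  $AB = \lambda^2$. They are sums of $k^2$ roots of unity of order dividing $p^2$, hence integers
  congruent to $k^2$ modulo $p$. As $\lambda \equiv -k^2(m-1)$, this forces $m \equiv 0$ or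
  $m \equiv 2$ modulo $p$. Because $\lambda \le k$ and $km \le p^2$, the first case contradicts
  $B \equiv \lambda$; in the second, $B = p - \lambda$ divides $\lambda^2$, so $\lambda = k = p - 1$
  and $km > p^2$.\<close>

(* Keeps "order" meaning the order of a group: the imports also provide the order of a root. *)
hide_const (open) Polynomial.order

section \<open>Arithmetic of the parameters\<close>

text \<open>\<open>km\<close> says that the m disjoint blocks fit into the group; it gives k(m - 1)
  <= p^2 - 1, and comparison with the counting identity yields l <= k. If p divided k, then p^2
  would divide l, and p^2 <= l <= k would contradict 2k <= km <= p^2.\<close>

lemma SEDF_parameters_bounds:
  fixes p k m l :: int
  assumes p: "prime p" and k: "k > 1" and m: "m \<ge> 1" and l: "l \<ge> 1"
    and count: "k^2 * (m - 1) = l * (p^2 - 1)" and km: "k * m \<le> p^2"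
  shows "l \<le> k" "\<not> p dvd k"
proof -
  have p2: "p \<ge> 2" using p by (simp add: prime_ge_2_int)
  have p4: "p^2 \<ge> 4" using power_mono[of 2 p 2] p2 by simp
  have "k * (m - 1) \<le> p^2 - 1" using km k by (simp add: algebra_simps)
  then have "k * (k * (m - 1)) \<le> k * (p^2 - 1)" using k by (intro mult_left_mono) auto
  then have "l * (p^2 - 1) \<le> k * (p^2 - 1)" using count by (simp add: power2_eq_square mult.assoc)
  then show lk: "l \<le> k" using p4 by simp
  show "\<not> p dvd k"
  proof
    assume "p dvd k"
    then have "p^2 dvd k^2" by simp
    then have "p^2 dvd l * p^2 - k^2 * (m - 1)" by simp
    also have "l * p^2 - k^2 * (m - 1) = l" using count by (simp add: algebra_simps)
    finally have "p^2 \<le> l" using l by (simp add: zdvd_imp_le)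
    moreover have "m \<ge> 2"
    proof (rule ccontr)
      assume "\<not> m \<ge> 2"
      then have "m = 1" using m by simp
      then show False using count l p4 by simp
    qed
    then have "k * 2 \<le> k * m" using k by (intro mult_left_mono) auto
    ultimately show False using lk km k by simp
  qed
qed

text \<open>\<open>A\<close> and \<open>B\<close> stand for the two values of |chi(D_j)|^2. Modulo p
  both are k^2, and \<open>count\<close> gives l = -k^2 (m - 1), so AB = l^2 becomes k^4 = k^4 (m -
  1)^2; hence p divides k^4 m (m - 2).\<close>

lemma SEDF_parameters_contradiction:
  fixes p k m l A B :: int
  assumes p: "prime p" and k: "k > 1" and m: "m > 2" and l: "l \<ge> 1"
    and count: "k^2 * (m - 1) = l * (p^2 - 1)" and km: "k * m \<le> p^2"
    and A: "p dvd A - k^2" and B: "p dvd B - k^2"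
    and AB: "A * B = l^2" and B0: "0 < B" and Bl: "B < l"
  shows False
proof -
  have lk: "l \<le> k" and pk: "\<not> p dvd k"
    using SEDF_parameters_bounds[OF p k _ l count km] m by auto
  have p2: "p \<ge> 2" using p by (simp add: prime_ge_2_int)
  have l1: "p dvd l + k^2 * (m - 1)"
  proof -
    have "l + k^2 * (m - 1) = p * (p * l)" using count by (simp add: algebra_simps power2_eq_square)
    then show ?thesis by simp
  qed
  have "p dvd k^2 * k^2 * m * (m - 2)"
  proof -
    \<comment> \<open>Each summand on the right has a factor divisible by p; the excess AB - l^2
      vanishes.\<close>
    have "k^2 * k^2 * m * (m - 2) = (k^2 * (m - 1) + l) * (k^2 * (m - 1) - l) + (A - k^2) * B + k^2 * (B - k^2)"
      using AB by (simp add: algebra_simps power2_eq_square)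
    then show ?thesis using A B l1 by (simp add: add.commute)
  qed
  then consider "p dvd m" | "p dvd m - 2"
    using p pk by (auto simp: prime_dvd_mult_iff prime_dvd_power_iff)
  then show False
  proof cases
    \<comment> \<open>Here l = k^2 = B modulo p, so p <= l - B < l <= k, whereas km <= p^2 and p <=
      m give k <= p.\<close>
    case 1
    then have "p \<le> m" using m by (simp add: zdvd_imp_le)
    then have "k * p \<le> k * m" using k by simp
    then have "k * p \<le> p * p" using km by (simp only: power2_eq_square)
    then have "k \<le> p" using p2 by simp
    moreover have "p dvd l - B"
    proof -
      have "l - B = (l + k^2 * (m - 1)) - k^2 * m - (B - k^2)" by (simp add: algebra_simps)
      then show ?thesis using 1 l1 B by (simp only: dvd_diff dvd_mult)
    qed
    then have "p \<le> l - B" using Bl by (intro zdvd_imp_le) auto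
    ultimately show False using lk B0 by simp
  next
    \<comment> \<open>Here l = -k^2 = -B modulo p. Since m >= p + 2 forces k < p, the bounds 0 < l +
      B < 2l < 2p leave only l + B = p.\<close>
    case 2
    then have mp: "p \<le> m - 2" using m by (intro zdvd_imp_le) auto
    have "k < p"
    proof (rule ccontr)
      assume "\<not> k < p"
      then have "p * (p + 2) \<le> k * m" using mp p2 by (intro mult_mono) auto
      then show False using km p2 by (simp add: power2_eq_square algebra_simps)
    qed
    have "p dvd l + B"
    proof -
      have "l + B = (l + k^2 * (m - 1)) - k^2 * (m - 2) + (B - k^2)" by (simp add: algebra_simps)
      then show ?thesis using 2 l1 B by (simp only: dvd_diff dvd_mult dvd_add)
    qed
    then obtain q where q: "l + B = p * q" by blast
    have "0 < p * q" using q l B0 by simp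
    then have q0: "q > 0" using p2 by (simp add: zero_less_mult_iff)
    have "p * q < p * 2" using q Bl lk \<open>k < p\<close> by simp
    then have "q < 2" using p2 by simp
    then have "q = 1" using q0 by simp
    then have lB: "B = p - l" using q by simp
    \<comment> \<open>\<open>B\<close> = p - l is coprime to l but divides l^2 = AB, so it is 1;
      then l = p - 1 and l <= k < p determine k.\<close>
    have "coprime p l"
      using p l lk \<open>k < p\<close> by (intro prime_imp_coprime) (auto dest: zdvd_imp_le)
    then have "coprime B l" unfolding lB by (simp add: coprime_iff_gcd_eq_1 gcd_diff1)
    then have "coprime B (l^2)" by simp
    moreover have "B dvd l^2" using AB by (metis dvd_triv_right)
    ultimately have "B = 1" using B0 by (metis coprime_common_divisor dvd_refl zdvd1_eq abs_of_pos)
    then have "k = p - 1" using lB lk \<open>k < p\<close> by simp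
    have "(p - 1) * (p + 2) \<le> (p - 1) * m" using mp p2 by (intro mult_left_mono) auto
    then have "(p - 1) * (p + 2) \<le> p^2" using km \<open>k = p - 1\<close> by simp
    then have "p \<le> 2" by (simp add: algebra_simps power2_eq_square)
    then show False using \<open>k = p - 1\<close> k by simp
  qed
qed

text \<open>The quadratic has one negative root and one root above n. Since the \<open>r j\<close>
  add up to n > 0, neither root can occur alone, and the multiplicities then express both roots
  rationally. It is meant for r_j = |chi(D_j)|^2 - l and n = |chi(D)|^2.\<close>

lemma two_valued_sum:
  fixes r :: "'i \<Rightarrow> real" and n l :: real
  assumes fin: "finite J" and card: "card J > 2" and n: "n > 0" and l: "l > 0"
    and quad: "\<And>j. j \<in> J \<Longrightarrow> (r j)^2 = n * r j + l * n"
    and total: "sum r J = n" and lrat: "l \<in> \<rat>"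
  shows "\<exists>i\<in>J. \<exists>j\<in>J. r i + l \<in> \<rat> \<and> r j + l \<in> \<rat> \<and> (r i + l) * (r j + l) = l^2
           \<and> 0 < r j + l \<and> r j + l < l"
proof -
  define P where "P = {j\<in>J. r j > 0}"
  define M where "M = {j\<in>J. r j < 0}"
  have r0: "r j \<noteq> 0" if "j \<in> J" for j using quad[OF that] n l by auto
  have J: "J = P \<union> M" "P \<inter> M = {}" "finite P" "finite M"
    using r0 fin unfolding P_def M_def by (auto simp: less_le)
  have rn: "r j > n" if "j \<in> P" for j
  proof -
    have "r j * (r j - n) = l * n" using quad[of j] that
      unfolding P_def by (simp add: algebra_simps power2_eq_square)
    then have "r j * (r j - n) > 0" using n l by simp
    then show ?thesis using that unfolding P_def by (simp add: zero_less_mult_iff)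
  qed
  have diff: "r i = r j \<or> r i + r j = n" if "i \<in> J" "j \<in> J" for i j
  proof -
    have "(r i - r j) * (r i + r j - n) = 0"
      using quad[OF that(1)] quad[OF that(2)] by (simp add: algebra_simps power2_eq_square)
    then show ?thesis by auto
  qed
  have "P \<noteq> {}"
  proof
    assume "P = {}"
    then have "sum r J \<le> 0" using J unfolding M_def by (intro sum_nonpos) (force simp: less_le)
    then show False using total n by simp
  qed
  then obtain i where i: "i \<in> P" by blast
  have "M \<noteq> {}"
  proof
    assume "M = {}"
    then have JP: "J = P" using J by simp
    have "sum r P = r i + sum r (P - {i})" using J(3) i by (simp add: sum.remove)
    moreover have "sum r (P - {i}) \<ge> 0" unfolding P_def by (intro sum_nonneg) auto
    ultimately show False using total JP rn[OF i] by simp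
  qed
  then obtain j where j: "j \<in> M" by blast
  have iJ: "i \<in> J" "j \<in> J" and ij: "r i > 0" "r j < 0" using i j unfolding P_def M_def by auto
  have rsum: "r i + r j = n" using diff[OF iJ] ij by auto
  have P: "r x = r i" if "x \<in> P" for x
    using diff[of x i] that rn[OF that] rn[OF i] n iJ J by auto
  have M: "r x = r j" if "x \<in> M" for x
    using diff[of x j] that j n iJ J unfolding M_def by auto
  \<comment> \<open>The roots sum to n, so one copy of each already accounts for the total. The
    remaining \<open>u\<close> copies of \<open>r i\<close> and \<open>w\<close> copies of
    \<open>r j\<close> cancel; more than two indices and opposite signs make both numbers
    positive.\<close>
  define u where "u = real (card P) - 1"
  define w where "w = real (card M) - 1"
  have "sum r J = sum r P + sum r M" using J by (simp add: sum.union_disjoint)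
  also have "\<dots> = (u + 1) * r i + (w + 1) * r j" using P M unfolding u_def w_def by simp
  finally have uw: "u * r i = - (w * r j)" using total rsum by (simp add: algebra_simps)
  have "card P \<ge> 1" "card M \<ge> 1" using \<open>P \<noteq> {}\<close> \<open>M \<noteq> {}\<close> J by (auto simp: Suc_le_eq card_gt_0_iff)
  then have uw0: "u \<ge> 0" "w \<ge> 0" unfolding u_def w_def by auto
  have "card J = card P + card M" using J by (simp add: card_Un_disjoint)
  then have "u + w > 0" using card unfolding u_def w_def by auto
  moreover have "u = 0 \<longleftrightarrow> w = 0" using uw ij by auto
  ultimately have upos: "u > 0" and wpos: "w > 0" using uw0 by auto
  have "r i * r i = (r i + r j) * r i + l * n"
    using quad[OF iJ(1)] by (simp add: rsum power2_eq_square)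
  then have rprod: "r i * r j = - (l * n)" by (simp add: algebra_simps)
  have "(r i + l) * (r j + l) = r i * r j + l * (r i + r j) + l^2"
    by (simp add: algebra_simps power2_eq_square)
  then have prod: "(r i + l) * (r j + l) = l^2" by (simp add: rprod rsum)
  \<comment> \<open>Multiply the cancellation relation by \<open>r i\<close>, insert the product and
    the sum of the roots, and cancel \<open>r i\<close> again.\<close>
  have e1: "u * (r i + l) = l * w"
  proof -
    have "r i * (u * r i) = - w * (r i * r j)" unfolding uw by simp
    also have "\<dots> = l * (w * r i + w * r j)"
      unfolding rprod rsum[symmetric] by (simp add: algebra_simps)
    also have "w * r j = - (u * r i)" using uw by simp
    finally have "r i * (u * r i) = r i * (l * (w - u))" by (simp add: algebra_simps)
    then have "u * r i = l * (w - u)" using ij by simp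
    then show ?thesis by (simp add: algebra_simps)
  qed
  have "r i + l = l * w / u" using e1 upos by (simp add: field_simps)
  moreover have "r j + l = l * u / w"
  proof -
    have "(l * w / u) * (r j + l) = l^2" using prod calculation by simp
    then have "l * (w * (r j + l)) = l * (l * u)"
      using upos by (simp add: field_simps power2_eq_square)
    then have "w * (r j + l) = l * u" using l by simp
    then show ?thesis using wpos by (simp add: field_simps)
  qed
  moreover have "u \<in> \<rat>" "w \<in> \<rat>" unfolding u_def w_def by auto
  moreover have "l * u / w > 0" using upos wpos l by simp
  ultimately show ?thesis using prod ij iJ lrat by (intro bexI[of _ i] bexI[of _ j]) auto
qed

section \<open>Sums of roots of unity\<close>

text \<open>The vector \<open>w\<close> is an eigenvector of the integer matrix \<open>M\<close> for
  \<open>z\<close>, so \<open>z\<close> is a root of a characteristic polynomial that is monic and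
  integral.\<close>

lemma integer_eigenvalue_algebraic_int:
  fixes w :: "nat \<Rightarrow> complex" and M :: "nat \<Rightarrow> nat \<Rightarrow> int"
  assumes eig: "\<And>i. i < n \<Longrightarrow> z * w i = (\<Sum>j<n. of_int (M i j) * w j)"
    and nz: "i0 < n" "w i0 \<noteq> 0"
  shows "algebraic_int z"
proof -
  define A where "A = mat n n (\<lambda>(i, j). M i j)"
  have A: "A \<in> carrier_mat n n" unfolding A_def by simp
  have A': "map_mat complex_of_int A \<in> carrier_mat n n" using A by simp
  have "eigenvector (map_mat complex_of_int A) (vec n w) z"
    unfolding eigenvector_def
  proof (intro conjI)
    show "vec n w \<in> carrier_vec (dim_row (map_mat complex_of_int A))" using A by auto
    have "vec n w $ i0 \<noteq> 0\<^sub>v n $ i0" using nz by simp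
    then show "vec n w \<noteq> 0\<^sub>v (dim_row (map_mat complex_of_int A))" using A by auto
    show "map_mat complex_of_int A *\<^sub>v vec n w = z \<cdot>\<^sub>v vec n w"
      by (intro eq_vecI) (auto simp: A_def scalar_prod_def eig lessThan_atLeast0)
  qed
  then have "poly (char_poly (map_mat complex_of_int A)) z = 0"
    using eigenvalue_root_char_poly[OF A'] unfolding eigenvalue_def by blast
  then have root: "poly (map_poly of_int (char_poly A)) z = 0"
    by (simp add: of_int_hom.char_poly_hom[OF A])
  show ?thesis
    unfolding algebraic_int_altdef_ipoly
    using root degree_monic_char_poly[OF A] by (intro exI[of _ "char_poly A"]) auto
qed

lemma primitive_root_of_unity_exists:
  assumes "n > 0"
  obtains z :: complex where "z ^ n = 1" "\<And>x. x ^ n = 1 \<Longrightarrow> \<exists>k. x = z ^ k"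
    "\<And>k. \<lbrakk>0 < k; k < n\<rbrakk> \<Longrightarrow> z ^ k \<noteq> 1"
proof
  define z where "z = cis (2 * pi / real n)"
  have zk: "cis (2 * pi * real k / real n) = z ^ k" for k
    unfolding z_def DeMoivre by (simp add: field_simps)
  have bij: "bij_betw (\<lambda>k. z ^ k) {..<n} {x. x ^ n = 1}"
    using bij_betw_roots_unity[OF assms] by (simp add: zk)
  show "z ^ n = 1" unfolding z_def DeMoivre using assms by simp
  show "\<exists>k. x = z ^ k" if "x ^ n = 1" for x
    using bij_betw_imp_surj_on[OF bij] that by blast
  show "z ^ k \<noteq> 1" if "0 < k" "k < n" for k
    using bij_betw_imp_inj_on[OF bij] that inj_onD[of "\<lambda>k. z ^ k" "{..<n}" k 0] by auto
qed

section \<open>The ring Z[z]: rational elements, and p-th powers modulo p\<close>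

definition int_adjoin :: "complex \<Rightarrow> complex set"
  where "int_adjoin z = range (\<lambda>f. poly (map_poly of_int f) z)"

lemma int_adjoin_add: "x \<in> int_adjoin z \<Longrightarrow> y \<in> int_adjoin z \<Longrightarrow> x + y \<in> int_adjoin z"
  unfolding int_adjoin_def by (auto simp flip: of_int_poly_hom.hom_add poly_add)

lemma int_adjoin_mult: "x \<in> int_adjoin z \<Longrightarrow> y \<in> int_adjoin z \<Longrightarrow> x * y \<in> int_adjoin z"
  unfolding int_adjoin_def by (auto simp flip: of_int_poly_hom.hom_mult poly_mult)

lemma int_adjoin_of_int: "of_int c \<in> int_adjoin z"
  unfolding int_adjoin_def by (rule range_eqI[of _ _ "[:c:]"]) (simp add: of_int_hom.map_poly_pCons_hom)

lemma int_adjoin_gen: "z \<in> int_adjoin z"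
  unfolding int_adjoin_def by (rule range_eqI[of _ _ "[:0, 1:]"]) (simp add: of_int_hom.map_poly_pCons_hom)

lemma int_adjoin_power: "x \<in> int_adjoin z \<Longrightarrow> x ^ n \<in> int_adjoin z"
  using int_adjoin_of_int[of 1] by (induction n) (auto intro: int_adjoin_mult)

lemma int_adjoin_sum: "(\<And>i. i \<in> I \<Longrightarrow> f i \<in> int_adjoin z) \<Longrightarrow> sum f I \<in> int_adjoin z"
  using int_adjoin_of_int[of 0] by (induction I rule: infinite_finite_induct) (auto intro: int_adjoin_add)

lemma int_adjoin_root_of_unity:
  assumes "z ^ n = 1" "n > 0" "x \<in> int_adjoin z"
  shows "\<exists>c::nat \<Rightarrow> int. x = (\<Sum>i<n. of_int (c i) * z ^ i)"
proof -
  obtain m where n: "n = Suc m" using assms(2) by (cases n) auto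
  have "\<exists>c::nat \<Rightarrow> int. poly (map_poly of_int f) z = (\<Sum>i<n. of_int (c i) * z ^ i)" for f :: "int poly"
  proof (induction f)
    case 0
    show ?case by (intro exI[of _ "\<lambda>_. 0"]) simp
  next
    case (pCons a f)
    then obtain c :: "nat \<Rightarrow> int" where c: "poly (map_poly of_int f) z = (\<Sum>i<n. of_int (c i) * z ^ i)"
      by blast
    \<comment> \<open>Multiplication by \<open>z\<close> rotates the coefficients: the last one,
      \<open>c m\<close>, wraps around to position 0 because z^n = 1, and joins the new constant
      term \<open>a\<close>.\<close>
    define c' where "c' i = (if i = 0 then a + c m else c (i - 1))" for i
    have "poly (map_poly of_int (pCons a f)) z = of_int a + z * (\<Sum>i<n. of_int (c i) * z ^ i)"
      using c by (simp add: of_int_hom.map_poly_pCons_hom)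
    also have "\<dots> = of_int a + of_int (c m) * z ^ n + (\<Sum>i<m. of_int (c i) * z ^ Suc i)"
      unfolding n by (simp add: sum_distrib_left algebra_simps)
    also have "\<dots> = (\<Sum>i<n. of_int (c' i) * z ^ i)"
      unfolding assms(1) unfolding n c'_def by (subst sum.lessThan_Suc_shift) simp
    finally show ?case by blast
  qed
  then show ?thesis using assms(3) unfolding int_adjoin_def by blast
qed

text \<open>Multiplication by \<open>x\<close> preserves the integer span of 1, z, ..., z^(n-1),
  which makes \<open>x\<close> an eigenvalue of an integer matrix. Hence \<open>x\<close> is an
  algebraic integer, and rational algebraic integers are integers.\<close>

lemma int_adjoin_rational:
  assumes z: "z ^ n = 1" "n > 0" and x: "x \<in> int_adjoin z" "x \<in> \<rat>"
  shows "x \<in> \<int>"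
proof -
  have "\<exists>c::nat \<Rightarrow> int. x * z ^ i = (\<Sum>j<n. of_int (c j) * z ^ j)" for i
    using z x int_adjoin_gen by (intro int_adjoin_root_of_unity) (auto intro: int_adjoin_mult int_adjoin_power)
  then obtain M :: "nat \<Rightarrow> nat \<Rightarrow> int" where "x * z ^ i = (\<Sum>j<n. of_int (M i j) * z ^ j)" for i
    by metis
  then have "algebraic_int x"
    using z by (intro integer_eigenvalue_algebraic_int[of n x "\<lambda>i. z ^ i" M 0]) auto
  then show ?thesis using x by (intro rational_algebraic_int_is_int)
qed

text \<open>The inner binomial coefficients are divisible by p. The quotient \<open>r\<close> is
  kept in Z[z], so that this is a congruence modulo p in that ring.\<close>

lemma int_adjoin_binomial_prime:
  assumes p: "prime p" and x: "x \<in> int_adjoin z" and y: "y \<in> int_adjoin z"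
  shows "\<exists>r\<in>int_adjoin z. (x + y) ^ p = x ^ p + y ^ p + of_nat p * r"
proof -
  have p0: "p > 0" using p by (rule prime_gt_0_nat)
  define r where "r = (\<Sum>k\<in>{1..<p}. of_nat ((p choose k) div p) * x ^ k * y ^ (p - k))"
  have "(x + y) ^ p = (\<Sum>k\<le>p. of_nat (p choose k) * x ^ k * y ^ (p - k))"
    by (rule binomial_ring)
  also have "{..p} = insert 0 (insert p {1..<p})" using p0 by auto
  also have "(\<Sum>k\<in>insert 0 (insert p {1..<p}). of_nat (p choose k) * x ^ k * y ^ (p - k))
      = x ^ p + y ^ p + (\<Sum>k\<in>{1..<p}. of_nat (p choose k) * x ^ k * y ^ (p - k))"
    using p0 by simp
  also have "(\<Sum>k\<in>{1..<p}. of_nat (p choose k) * x ^ k * y ^ (p - k)) = of_nat p * r"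
    unfolding r_def sum_distrib_left
  proof (rule sum.cong)
    fix k assume "k \<in> {1..<p}"
    then have "p dvd p choose k" using p by (intro dvd_choose_prime) auto
    then have "p choose k = p * ((p choose k) div p)" by simp
    then show "of_nat (p choose k) * x ^ k * y ^ (p - k)
        = of_nat p * (of_nat ((p choose k) div p) * x ^ k * y ^ (p - k))"
      by (metis mult.assoc of_nat_mult)
  qed simp
  finally have "(x + y) ^ p = x ^ p + y ^ p + of_nat p * r" .
  moreover have "r \<in> int_adjoin z"
    unfolding r_def using x y int_adjoin_of_int[of "int _"]
    by (intro int_adjoin_sum int_adjoin_mult int_adjoin_power) (auto simp del: of_nat_div)
  ultimately show ?thesis by blast
qed

lemma int_adjoin_frobenius:
  assumes p: "prime p" and f: "\<And>i. i \<in> I \<Longrightarrow> f i \<in> int_adjoin z"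
  shows "\<exists>r\<in>int_adjoin z. (\<Sum>i\<in>I. f i) ^ p = (\<Sum>i\<in>I. f i ^ p) + of_nat p * r"
  using f
proof (induction I rule: infinite_finite_induct)
  case (insert i I)
  then obtain r where r: "r \<in> int_adjoin z" "(\<Sum>i\<in>I. f i) ^ p = (\<Sum>i\<in>I. f i ^ p) + of_nat p * r"
    by auto
  obtain s where s: "s \<in> int_adjoin z"
    "(f i + (\<Sum>i\<in>I. f i)) ^ p = f i ^ p + (\<Sum>i\<in>I. f i) ^ p + of_nat p * s"
    using int_adjoin_binomial_prime[OF p, of "f i" z "\<Sum>i\<in>I. f i"] insert.prems
    by (auto intro: int_adjoin_sum)
  show ?case
    using insert.hyps r s by (intro bexI[of _ "r + s"]) (auto simp: algebra_simps intro: int_adjoin_add)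
qed (use int_adjoin_of_int[of 0 z] p in \<open>auto intro!: bexI[of _ 0] simp: prime_gt_0_nat\<close>)

lemma fermat_little_int:
  fixes a :: int
  assumes "prime p"
  shows "int p dvd a ^ p - a"
proof -
  have *: "[b ^ p = b] (mod p)" for b :: nat
  proof (cases "p dvd b")
    case True
    then have "p dvd b ^ p" using prime_gt_0_nat[OF assms] by (metis dvd_power dvd_trans)
    then show ?thesis using True by (simp add: cong_def)
  next
    case False
    then have "[b ^ (p - 1) * b = 1 * b] (mod p)"
      using fermat_theorem[OF assms] by (intro cong_mult) auto
    then show ?thesis using assms by (simp add: prime_gt_0_nat flip: power_Suc2)
  qed
  define b where "b = nat (a mod int p)"
  have b: "int b = a mod int p" unfolding b_def using assms by (simp add: prime_gt_0_nat)
  have "[int b ^ p = int b] (mod int p)" using *[of b] by (simp flip: cong_int_iff)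
  then have "[a ^ p = a] (mod int p)" unfolding b by (simp add: cong_def power_mod)
  then show ?thesis by (simp add: cong_iff_dvd_diff)
qed

text \<open>Everything lies in Z[z] for a generator \<open>z\<close> of the roots of unity of order
  dividing p^2, so the rational sum is an integer b. Taking p-th powers twice is additive modulo p
  and turns every summand into 1, so b^(p^2) is congruent to the number of summands; by Fermat it is
  also congruent to b.\<close>

lemma rational_sum_roots_of_unity:
  fixes f :: "'i \<Rightarrow> complex"
  assumes p: "prime p" and f: "\<And>i. i \<in> I \<Longrightarrow> f i ^ (p ^ 2) = 1" and rat: "sum f I \<in> \<rat>"
  shows "\<exists>b::int. sum f I = of_int b \<and> int p dvd b - int (card I)"
proof -
  have p0: "p > 0" using p by (rule prime_gt_0_nat)
  then obtain z :: complex where z: "z ^ (p ^ 2) = 1" and gen: "\<And>x. x ^ (p ^ 2) = 1 \<Longrightarrow> \<exists>k. x = z ^ k"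
    using primitive_root_of_unity_exists[of "p ^ 2"] by (metis zero_less_power)
  have fR: "f i \<in> int_adjoin z" if "i \<in> I" for i
    using gen[OF f[OF that]] int_adjoin_gen int_adjoin_power by auto
  have "sum f I \<in> int_adjoin z" using fR by (rule int_adjoin_sum)
  then have "sum f I \<in> \<int>" using int_adjoin_rational[OF z _ _ rat] p0 by simp
  then obtain b :: int where b: "sum f I = of_int b" by (auto elim: Ints_cases)
  have "\<exists>r\<in>int_adjoin z. sum f I ^ p = (\<Sum>i\<in>I. f i ^ p) + of_nat p * r"
    using fR by (rule int_adjoin_frobenius[OF p])
  then obtain r where r: "r \<in> int_adjoin z" "sum f I ^ p = (\<Sum>i\<in>I. f i ^ p) + of_nat p * r"
    by blast
  have "\<exists>s\<in>int_adjoin z. (\<Sum>i\<in>I. f i ^ p) ^ p = (\<Sum>i\<in>I. (f i ^ p) ^ p) + of_nat p * s"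
    using int_adjoin_power[OF fR] by (rule int_adjoin_frobenius[OF p])
  then obtain s where s: "s \<in> int_adjoin z" "(\<Sum>i\<in>I. f i ^ p) ^ p = (\<Sum>i\<in>I. (f i ^ p) ^ p) + of_nat p * s"
    by blast
  define t where "t = (\<Sum>i\<in>I. f i ^ p)"
  have t: "t \<in> int_adjoin z" unfolding t_def using fR by (intro int_adjoin_sum int_adjoin_power)
  have "of_nat p * r \<in> int_adjoin z"
    using int_adjoin_mult[OF int_adjoin_of_int[of "int p"] r(1)] by simp
  then obtain q where q: "q \<in> int_adjoin z"
    "(t + of_nat p * r) ^ p = t ^ p + (of_nat p * r) ^ p + of_nat p * q"
    using int_adjoin_binomial_prime[OF p t] by blast
  \<comment> \<open>Collects the error terms of both p-th powers: \<open>s\<close> and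
    \<open>q\<close> from additivity, the middle term from expanding (p r)^p.\<close>
  define h where "h = s + r * (of_nat p * r) ^ (p - 1) + q"
  have h: "h \<in> int_adjoin z"
    unfolding h_def using s q r int_adjoin_of_int[of "int p" z, simplified]
    by (intro int_adjoin_add int_adjoin_mult int_adjoin_power)
  have "(\<Sum>i\<in>I. (f i ^ p) ^ p) = (\<Sum>i\<in>I. 1)"
    using f by (intro sum.cong) (auto simp: power2_eq_square power_mult)
  moreover have "(of_nat p * r) ^ p = of_nat p * (r * (of_nat p * r) ^ (p - 1))"
    using p0 by (cases p) auto
  ultimately have eq: "of_int b ^ p ^ 2 = of_nat (card I) + of_nat p * h"
    using b r s q unfolding h_def t_def
    by (simp add: power2_eq_square power_mult algebra_simps)
  have pc: "of_nat p \<noteq> (0::complex)" using p0 by simp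
  \<comment> \<open>The error term is rational, hence an integer, so the congruence in Z[z] descends
    to one in Z.\<close>
  have "h = (of_int b ^ p ^ 2 - of_nat (card I)) / of_nat p"
    using eq pc by (simp add: field_simps)
  then have "h \<in> \<rat>" by simp
  then have "h \<in> \<int>" using int_adjoin_rational[OF z _ h] p0 by simp
  then obtain c :: int where "h = of_int c" by (auto elim: Ints_cases)
  then have "complex_of_int (b ^ p ^ 2) = complex_of_int (int (card I) + int p * c)" using eq by simp
  then have c: "b ^ p ^ 2 = int (card I) + int p * c" by (simp only: of_int_eq_iff)
  have "b - int (card I) = int p * c - ((b ^ p) ^ p - b ^ p) - (b ^ p - b)"
    using c by (simp add: power2_eq_square power_mult)
  then have "int p dvd b - int (card I)"
    using fermat_little_int[OF p, of b] fermat_little_int[OF p, of "b ^ p"] by (simp only: dvd_diff dvd_triv_left)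
  then show ?thesis using b by blast
qed

section \<open>Characters of finite abelian groups\<close>

text \<open>Values are plain complex numbers, so that they can be summed directly; the condition at
  the identity excludes the zero function.\<close>

definition group_char :: "('a, 'b) monoid_scheme \<Rightarrow> ('a \<Rightarrow> complex) \<Rightarrow> bool"
  where "group_char G \<chi> \<longleftrightarrow>
    \<chi> \<one>\<^bsub>G\<^esub> = 1 \<and> (\<forall>x\<in>carrier G. \<forall>y\<in>carrier G. \<chi> (x \<otimes>\<^bsub>G\<^esub> y) = \<chi> x * \<chi> y)"

context comm_group
begin

lemma group_char_power_order:
  assumes "group_char G \<chi>" "x \<in> carrier G"
  shows "\<chi> x ^ order G = 1"
proof -
  have "\<chi> (x [^] n) = \<chi> x ^ n" for n :: nat
    using assms by (induction n) (auto simp: group_char_def)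
  from this[of "order G"] show ?thesis
    using assms pow_order_eq_1[of x] by (simp add: group_char_def)
qed

lemma group_char_norm:
  assumes "group_char G \<chi>" "finite (carrier G)" "x \<in> carrier G"
  shows "norm (\<chi> x) = 1"
proof -
  have n: "order G > 0" using assms by (simp add: order_gt_0_iff_finite)
  have "norm (\<chi> x) ^ order G = 1"
    using group_char_power_order[OF assms(1,3)] by (simp flip: norm_power)
  then have "norm (\<chi> x) ^ order G = 1 ^ order G" by simp
  then show ?thesis using n by (intro power_eq_imp_eq_base[of _ "order G" 1]) simp_all
qed

text \<open>Character values lie on the unit circle, where inversion is conjugation.\<close>

lemma group_char_div:
  assumes \<chi>: "group_char G \<chi>" and fin: "finite (carrier G)" and x: "x \<in> carrier G" and y: "y \<in> carrier G"
  shows "\<chi> (x \<otimes> inv y) = \<chi> x * cnj (\<chi> y)"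
proof -
  have "\<chi> y * \<chi> (inv y) = \<chi> (y \<otimes> inv y)" using \<chi> y unfolding group_char_def by (metis inv_closed)
  also have "\<dots> = 1" using \<chi> y unfolding group_char_def by simp
  also have "1 = \<chi> y * cnj (\<chi> y)"
    using group_char_norm[OF \<chi> fin y] complex_norm_square[of "\<chi> y"] by simp
  finally have "\<chi> (inv y) = cnj (\<chi> y)"
    using group_char_norm[OF \<chi> fin y] by auto
  then show ?thesis using \<chi> x y by (simp add: group_char_def)
qed

text \<open>Translation by \<open>h\<close> permutes the group and multiplies the sum by \<chi>(h),
  which differs from 1.\<close>

lemma sum_group_char:
  assumes \<chi>: "group_char G \<chi>" and h: "h \<in> carrier G" "\<chi> h \<noteq> 1"
  shows "(\<Sum>x\<in>carrier G. \<chi> x) = 0"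
proof -
  have "bij_betw (\<lambda>x. h \<otimes> x) (carrier G) (carrier G)"
    using h by (intro bij_betwI[of _ _ _ "\<lambda>x. inv h \<otimes> x"]) (auto simp flip: m_assoc)
  then have "(\<Sum>x\<in>carrier G. \<chi> x) = (\<Sum>x\<in>carrier G. \<chi> (h \<otimes> x))"
    by (rule sum.reindex_bij_betw[symmetric])
  also have "\<dots> = \<chi> h * (\<Sum>x\<in>carrier G. \<chi> x)"
    using \<chi> h by (simp add: sum_distrib_left group_char_def)
  finally show ?thesis using h by simp
qed

text \<open>Projecting onto the eigenspaces of one translation after another yields a function that is
  an eigenvector of all translations, which is a multiple of a character.\<close>

lemma exists_translation_eigenfunction:
  fixes f :: "'a \<Rightarrow> complex"
  assumes fin: "finite (carrier G)" and f: "z \<in> carrier G" "f z \<noteq> 0"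
    and S: "finite S" "S \<subseteq> carrier G"
  shows "\<exists>u. (\<exists>x\<in>carrier G. (\<Sum>y\<in>carrier G. f y * u (x \<otimes> y)) \<noteq> 0) \<and>
             (\<forall>g\<in>S. \<exists>\<omega>. \<forall>x\<in>carrier G. u (g \<otimes> x) = \<omega> * u x)"
  using S
proof (induction S rule: finite_induct)
  case empty
  \<comment> \<open>The starting function is the indicator of \<open>z\<close>, whose pairing with
    \<open>f\<close> at the identity is \<open>f z\<close>.\<close>
  have "(\<Sum>y\<in>carrier G. f y * (if \<one> \<otimes> y = z then 1 else 0)) = (\<Sum>y\<in>carrier G. if y = z then f y else 0)"
    by (intro sum.cong) auto
  also have "\<dots> = f z" using fin f by simp
  finally show ?case using f
    by (intro exI[of _ "\<lambda>y. if y = z then 1 else 0"] conjI bexI[of _ \<one>]) auto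
next
  case (insert g S)
  then have g: "g \<in> carrier G" by simp
  obtain u x where x: "x \<in> carrier G" "(\<Sum>y\<in>carrier G. f y * u (x \<otimes> y)) \<noteq> 0"
    and u: "\<And>h. h \<in> S \<Longrightarrow> \<exists>\<omega>. \<forall>x\<in>carrier G. u (h \<otimes> x) = \<omega> * u x"
    using insert by auto
  define n where "n = order G"
  have n: "n > 0" unfolding n_def using fin by (simp add: order_gt_0_iff_finite)
  obtain \<zeta> :: complex where \<zeta>: "\<zeta> ^ n = 1" "\<And>k. \<lbrakk>0 < k; k < n\<rbrakk> \<Longrightarrow> \<zeta> ^ k \<noteq> 1"
    using primitive_root_of_unity_exists[OF n] by metis
  have \<zeta>0: "\<zeta> \<noteq> 0" using \<zeta>(1) n by (auto simp: power_0_left)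
  \<comment> \<open>Up to the factor n, \<open>U k\<close> is the projection of \<open>u\<close>
    onto the eigenspace of translation by \<open>g\<close> with eigenvalue \<zeta>^(-k).\<close>
  define U where "U k x = (\<Sum>i<n. \<zeta> ^ (k * i) * u (g [^] i \<otimes> x))" for k x
  have Ug: "U k (g \<otimes> y) = inverse (\<zeta> ^ k) * U k y" if y: "y \<in> carrier G" for k y
  proof -
    define h where "h i = \<zeta> ^ (k * i) * u (g [^] i \<otimes> y)" for i
    have "g [^] n = \<one>" using pow_order_eq_1[OF g] unfolding n_def by simp
    moreover have "\<zeta> ^ (k * n) = 1" using \<zeta>(1) by (metis mult.commute power_mult power_one)
    ultimately have hn: "h n = h 0" unfolding h_def by simp
    have "\<zeta> ^ k * U k (g \<otimes> y) = (\<Sum>i<n. h (Suc i))"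
      unfolding U_def h_def sum_distrib_left
      using g y by (intro sum.cong) (auto simp: power_add m_assoc)
    also have "\<dots> = (\<Sum>i<n. h i)"
      using sum.lessThan_Suc_shift[of h n] sum.lessThan_Suc[of h n] hn by simp
    also have "\<dots> = U k y" unfolding U_def h_def ..
    finally show ?thesis using \<zeta>0 by (simp add: field_simps)
  qed
  \<comment> \<open>Translations commute, so projecting keeps the eigenvalues already secured for
    \<open>S\<close>.\<close>
  have Uh: "\<exists>\<omega>. \<forall>y\<in>carrier G. U k (h \<otimes> y) = \<omega> * U k y" if h: "h \<in> S" for k h
  proof -
    obtain \<omega> where \<omega>: "\<And>y. y \<in> carrier G \<Longrightarrow> u (h \<otimes> y) = \<omega> * u y" using u[OF h] by blast
    have hG: "h \<in> carrier G" using h insert.prems by auto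
    have "U k (h \<otimes> y) = \<omega> * U k y" if y: "y \<in> carrier G" for y
      unfolding U_def sum_distrib_left
    proof (rule sum.cong)
      fix i :: nat
      have "g [^] i \<otimes> (h \<otimes> y) = h \<otimes> (g [^] i \<otimes> y)" using g hG y by (simp add: m_lcomm)
      then show "\<zeta> ^ (k * i) * u (g [^] i \<otimes> (h \<otimes> y)) = \<omega> * (\<zeta> ^ (k * i) * u (g [^] i \<otimes> y))"
        using \<omega>[of "g [^] i \<otimes> y"] g y by simp
    qed simp
    then show ?thesis by blast
  qed
  \<comment> \<open>By orthogonality of roots of unity the projections add up to n u, so at least
    one of them keeps a nonzero pairing with \<open>f\<close> at the same \<open>x\<close>.\<close>
  have Usum: "(\<Sum>k<n. U k y) = of_nat n * u y" if y: "y \<in> carrier G" for y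
  proof -
    have geo: "(\<Sum>k<n. \<zeta> ^ (k * i)) = (if i = 0 then of_nat n else 0)" if "i < n" for i
    proof (cases "i = 0")
      case False
      have "(\<Sum>k<n. \<zeta> ^ (k * i)) = (\<Sum>k<n. (\<zeta> ^ i) ^ k)"
        by (simp add: mult.commute flip: power_mult)
      also have "\<dots> = ((\<zeta> ^ i) ^ n - 1) / (\<zeta> ^ i - 1)"
        using \<zeta>(2) that False by (intro geometric_sum) auto
      also have "(\<zeta> ^ i) ^ n = 1" using \<zeta>(1) by (metis mult.commute power_mult power_one)
      finally show ?thesis using False by simp
    qed simp
    have "(\<Sum>k<n. U k y) = (\<Sum>i<n. (\<Sum>k<n. \<zeta> ^ (k * i)) * u (g [^] i \<otimes> y))"
      unfolding U_def by (subst sum.swap) (simp add: sum_distrib_right)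
    also have "\<dots> = (\<Sum>i<n. if i = 0 then of_nat n * u y else 0)"
      using y geo by (intro sum.cong) auto
    also have "\<dots> = of_nat n * u y" using n by simp
    finally show ?thesis .
  qed
  have "(\<Sum>k<n. \<Sum>y\<in>carrier G. f y * U k (x \<otimes> y)) = (\<Sum>y\<in>carrier G. f y * (\<Sum>k<n. U k (x \<otimes> y)))"
    by (subst sum.swap) (simp add: sum_distrib_left)
  also have "\<dots> = of_nat n * (\<Sum>y\<in>carrier G. f y * u (x \<otimes> y))"
    using x Usum by (simp add: sum_distrib_left algebra_simps)
  also have "\<dots> \<noteq> 0" using x n by simp
  finally obtain k where "(\<Sum>y\<in>carrier G. f y * U k (x \<otimes> y)) \<noteq> 0"
    by (rule sum.not_neutral_contains_not_neutral)
  then show ?case using x Ug Uh by (intro exI[of _ "U k"]) auto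
qed

text \<open>Completeness of characters: a nonzero function has a nonzero Fourier coefficient. A
  common eigenfunction \<open>u\<close> of all translations equals u(1) times its eigenvalue
  function \<chi>. Here u(1) is nonzero, so evaluating \<open>u\<close> at products shows that
  \<chi> is multiplicative, and the pairing with \<open>u\<close> is a multiple of that with
  \<chi>.\<close>

lemma exists_group_char_nonzero:
  fixes f :: "'a \<Rightarrow> complex"
  assumes fin: "finite (carrier G)" and f: "z \<in> carrier G" "f z \<noteq> 0"
  shows "\<exists>\<chi>. group_char G \<chi> \<and> (\<Sum>y\<in>carrier G. f y * \<chi> y) \<noteq> 0"
proof -
  obtain u x where x: "x \<in> carrier G" "(\<Sum>y\<in>carrier G. f y * u (x \<otimes> y)) \<noteq> 0"
    and "\<forall>g\<in>carrier G. \<exists>\<omega>. \<forall>x\<in>carrier G. u (g \<otimes> x) = \<omega> * u x"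
    using exists_translation_eigenfunction[of z f "carrier G"] assms by auto
  then obtain \<chi> where \<chi>: "\<And>g x. g \<in> carrier G \<Longrightarrow> x \<in> carrier G \<Longrightarrow> u (g \<otimes> x) = \<chi> g * u x"
    by metis
  have u1: "u g = \<chi> g * u \<one>" if "g \<in> carrier G" for g
    using \<chi>[of g \<one>] that by simp
  have u0: "u \<one> \<noteq> 0"
  proof
    assume "u \<one> = 0"
    then have "u (x \<otimes> y) = 0" if "y \<in> carrier G" for y using u1[of "x \<otimes> y"] x that by simp
    then show False using x by simp
  qed
  have "\<chi> \<one> = 1" using u1[of \<one>] u0 by simp
  moreover have "\<chi> (g \<otimes> h) = \<chi> g * \<chi> h" if "g \<in> carrier G" "h \<in> carrier G" for g h
  proof -
    have "\<chi> (g \<otimes> h) * u \<one> = u (g \<otimes> h)" using u1[of "g \<otimes> h"] that by simp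
    also have "\<dots> = \<chi> g * u h" by (rule \<chi>[OF that])
    also have "\<dots> = \<chi> g * \<chi> h * u \<one>" unfolding u1[OF that(2)] by simp
    finally have "\<chi> (g \<otimes> h) * u \<one> = \<chi> g * \<chi> h * u \<one>" .
    then show ?thesis using u0 by simp
  qed
  ultimately have char: "group_char G \<chi>" unfolding group_char_def by blast
  have "u (x \<otimes> y) = \<chi> x * u \<one> * \<chi> y" if "y \<in> carrier G" for y
    using \<chi>[OF x(1) that] u1[OF that] by simp
  then have "(\<Sum>y\<in>carrier G. f y * u (x \<otimes> y)) = \<chi> x * u \<one> * (\<Sum>y\<in>carrier G. f y * \<chi> y)"
    by (simp add: sum_distrib_left mult_ac)
  then show ?thesis using char x by auto
qed

text \<open>Apply completeness to the indicator of \<open>E\<close> minus its mean \<open>c\<close>.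
  The trivial character annihilates this function, so the character found is nontrivial, and for
  such a character the constant \<open>c\<close> contributes nothing.\<close>

lemma exists_group_char_subset:
  assumes fin: "finite (carrier G)" and E: "E \<subseteq> carrier G" "E \<noteq> {}" "E \<noteq> carrier G"
  shows "\<exists>\<chi>. group_char G \<chi> \<and> (\<exists>h\<in>carrier G. \<chi> h \<noteq> 1) \<and> (\<Sum>x\<in>E. \<chi> x) \<noteq> 0"
proof -
  define c :: complex where "c = of_nat (card E) / of_nat (order G)"
  define f :: "'a \<Rightarrow> complex" where "f x = (if x \<in> E then 1 else 0) - c" for x
  have n: "order G > 0" using fin by (simp add: order_gt_0_iff_finite)
  obtain z where z: "z \<in> carrier G" "z \<notin> E" using E by blast
  have finE: "finite E" using E fin finite_subset by blast
  then have "c \<noteq> 0" unfolding c_def using E n by simp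
  then have "f z \<noteq> 0" unfolding f_def using z by simp
  then obtain \<chi> where \<chi>: "group_char G \<chi>" and nz: "(\<Sum>y\<in>carrier G. f y * \<chi> y) \<noteq> 0"
    using exists_group_char_nonzero[OF fin z(1)] by blast
  have "(\<Sum>y\<in>carrier G. f y * \<chi> y) = (\<Sum>y\<in>carrier G. (if y \<in> E then \<chi> y else 0) - c * \<chi> y)"
    unfolding f_def by (intro sum.cong) (auto simp: algebra_simps)
  also have "\<dots> = (\<Sum>y\<in>E. \<chi> y) - c * (\<Sum>y\<in>carrier G. \<chi> y)"
    using E fin by (simp add: sum_subtractf sum_distrib_left Int_absorb1 flip: sum.inter_restrict)
  finally have eq: "(\<Sum>y\<in>carrier G. f y * \<chi> y) = (\<Sum>y\<in>E. \<chi> y) - c * (\<Sum>y\<in>carrier G. \<chi> y)" .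
  have nontriv: "\<exists>h\<in>carrier G. \<chi> h \<noteq> 1"
  proof (rule ccontr)
    assume "\<not> (\<exists>h\<in>carrier G. \<chi> h \<noteq> 1)"
    then have "(\<Sum>y\<in>E. \<chi> y) = (\<Sum>y\<in>E. 1)" "(\<Sum>y\<in>carrier G. \<chi> y) = (\<Sum>y\<in>carrier G. 1)"
      using E(1) by (auto intro!: sum.cong simp del: sum_constant)
    then show False using eq nz n unfolding c_def Coset.order_def by simp
  qed
  then show ?thesis using \<chi> eq nz sum_group_char by auto
qed

end

section \<open>Character values of an SEDF\<close>

text \<open>Expand the product over pairs from \<open>D j\<close> and the union of the other blocks,
  and group the pairs by their quotient. Disjointness excludes the identity, and every other
  quotient occurs l times.\<close>

lemma SEDF_char_sum:
  fixes G (structure)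
  assumes S: "SEDF G v m k l D" and \<chi>: "group_char G \<chi>" and j: "j \<in> {1..m}"
  shows "(\<Sum>x\<in>D j. \<chi> x) * cnj (\<Sum>i\<in>{1..m} - {j}. \<Sum>y\<in>D i. \<chi> y)
           = of_nat l * (\<Sum>g\<in>carrier G - {\<one>\<^bsub>G\<^esub>}. \<chi> g)"
proof -
  have G: "comm_group G" and fin: "finite (carrier G)"
    and D: "\<And>i. i \<in> {1..m} \<Longrightarrow> D i \<subseteq> carrier G" and disj: "disjoint_family_on D {1..m}"
    and count: "\<And>g. g \<in> carrier G - {\<one>\<^bsub>G\<^esub>} \<Longrightarrow>
      card {(x, y). x \<in> D j \<and> y \<in> (\<Union>i\<in>{1..m} - {j}. D i) \<and> x \<otimes>\<^bsub>G\<^esub> inv\<^bsub>G\<^esub> y = g} = l"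
    using S j unfolding SEDF_def by blast+
  interpret comm_group G by (rule G)
  define E where "E = (\<Union>i\<in>{1..m} - {j}. D i)"
  have finD: "finite (D i)" if "i \<in> {1..m}" for i using D[OF that] fin finite_subset by blast
  have EG: "E \<subseteq> carrier G" and DG: "D j \<subseteq> carrier G" unfolding E_def using D j by blast+
  have finE: "finite E" using EG fin finite_subset by blast
  have dE: "D j \<inter> E = {}" using disj j unfolding E_def disjoint_family_on_def by blast
  have Esum: "(\<Sum>y\<in>E. \<chi> y) = (\<Sum>i\<in>{1..m} - {j}. \<Sum>y\<in>D i. \<chi> y)"
    unfolding E_def using finD disj unfolding disjoint_family_on_def
    by (intro sum.UNION_disjoint) auto
  define F where "F g = {q \<in> D j \<times> E. fst q \<otimes> inv (snd q) = g}" for g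
  have F: "card (F g) = l" if "g \<in> carrier G - {\<one>}" for g
  proof -
    have "F g = {(x, y). x \<in> D j \<and> y \<in> (\<Union>i\<in>{1..m} - {j}. D i) \<and> x \<otimes> inv y = g}"
      unfolding F_def E_def by auto
    then show ?thesis using count[OF that] by simp
  qed
  have "(\<Sum>x\<in>D j. \<chi> x) * cnj (\<Sum>y\<in>E. \<chi> y) = (\<Sum>q\<in>D j \<times> E. \<chi> (fst q) * cnj (\<chi> (snd q)))"
    unfolding cnj_sum sum_product sum.cartesian_product case_prod_unfold ..
  also have "\<dots> = (\<Sum>q\<in>D j \<times> E. \<chi> (fst q \<otimes> inv (snd q)))"
    using EG DG by (intro sum.cong) (auto simp: group_char_div[OF \<chi> fin] subset_iff)
  also have "\<dots> = (\<Sum>g\<in>carrier G - {\<one>}. \<Sum>q\<in>F g. \<chi> (fst q \<otimes> inv (snd q)))"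
    unfolding F_def
  proof (rule sum.group[symmetric])
    show "(\<lambda>q. fst q \<otimes> inv snd q) ` (D j \<times> E) \<subseteq> carrier G - {\<one>}"
    proof clarsimp
      fix x y assume xy: "x \<in> D j" "y \<in> E"
      then have "x \<in> carrier G" "y \<in> carrier G" "x \<noteq> y" using EG DG dE by auto
      moreover from this have "x \<otimes> inv y \<noteq> \<one>" using inv_equality[of x "inv y"] by auto
      ultimately show "x \<otimes> inv y \<in> carrier G \<and> x \<otimes> inv y \<noteq> \<one>" by simp
    qed
  qed (use fin finE finD[OF j] in auto)
  also have "\<dots> = (\<Sum>g\<in>carrier G - {\<one>}. of_nat (card (F g)) * \<chi> g)"
  proof (rule sum.cong)
    fix g
    have "(\<Sum>q\<in>F g. \<chi> (fst q \<otimes> inv (snd q))) = (\<Sum>q\<in>F g. \<chi> g)"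
      unfolding F_def by (rule sum.cong) simp_all
    then show "(\<Sum>q\<in>F g. \<chi> (fst q \<otimes> inv (snd q))) = of_nat (card (F g)) * \<chi> g" by simp
  qed simp
  also have "\<dots> = of_nat l * (\<Sum>g\<in>carrier G - {\<one>}. \<chi> g)"
    using F by (simp add: sum_distrib_left)
  finally show ?thesis unfolding Esum .
qed

text \<open>The trivial character turns the character identity for the first block into a count of
  pairs.\<close>

lemma SEDF_count:
  fixes G (structure)
  assumes S: "SEDF G v m k l D" and m: "m \<ge> 1"
  shows "k^2 * (m - 1) = l * (v - 1)"
proof -
  have G: "comm_group G" and fin: "finite (carrier G)" and v: "order G = v"
    and k: "\<And>i. i \<in> {1..m} \<Longrightarrow> card (D i) = k"
    using S unfolding SEDF_def by auto
  interpret comm_group G by (rule G)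
  have "group_char G (\<lambda>_. 1)" unfolding group_char_def by simp
  from SEDF_char_sum[OF S this, of 1]
  have "of_nat (card (D 1)) * of_nat (\<Sum>i\<in>{1..m} - {1}. card (D i)) = (of_nat l * of_nat (card (carrier G - {\<one>})) :: complex)"
    using m by simp
  then have "card (D 1) * (\<Sum>i\<in>{1..m} - {1}. card (D i)) = l * card (carrier G - {\<one>})"
    by (simp only: of_nat_eq_iff flip: of_nat_mult)
  moreover have "card (carrier G - {\<one>}) = v - 1"
    using v fin unfolding Coset.order_def by simp
  moreover have "(\<Sum>i\<in>{1..m} - {1}. card (D i)) = (m - 1) * k"
    using k m by simp
  ultimately show ?thesis using k[of 1] m by (simp add: power2_eq_square mult_ac)
qed

text \<open>A nontrivial character sums to -1 off the identity, so X_i cnj(T - X_i) = -l with X_i =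
  chi(D_i) and T = chi(D). Thus X_i cnj(T) = |X_i|^2 - l is real, and its squared modulus gives the
  quadratic for \<open>two_valued_sum\<close>.\<close>

lemma SEDF_char_values:
  fixes G (structure)
  assumes S: "SEDF G v m k l D" and m: "m > 2" and \<chi>: "group_char G \<chi>"
    and h: "h \<in> carrier G" "\<chi> h \<noteq> 1"
    and nz: "(\<Sum>i\<in>{1..m}. \<Sum>x\<in>D i. \<chi> x) \<noteq> 0"
  shows "\<exists>i\<in>{1..m}. \<exists>j\<in>{1..m}. \<exists>A B. A \<in> \<rat> \<and> B \<in> \<rat> \<and>
    complex_of_real A = (\<Sum>x\<in>D i. \<chi> x) * cnj (\<Sum>x\<in>D i. \<chi> x) \<and>
    complex_of_real B = (\<Sum>x\<in>D j. \<chi> x) * cnj (\<Sum>x\<in>D j. \<chi> x) \<and>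
    A * B = (real l)^2 \<and> 0 < B \<and> B < real l"
proof -
  have G: "comm_group G" and fin: "finite (carrier G)" and l: "l \<ge> 1"
    using S unfolding SEDF_def by auto
  interpret comm_group G by (rule G)
  define X where "X i = (\<Sum>x\<in>D i. \<chi> x)" for i
  define T where "T = (\<Sum>i\<in>{1..m}. X i)"
  define n where "n = (cmod T)^2"
  define r where "r i = (cmod (X i))^2 - real l" for i
  have T: "T \<noteq> 0" using nz unfolding T_def X_def .
  have Tn: "T * cnj T = of_real n" unfolding n_def complex_norm_square ..
  have "(\<Sum>g\<in>carrier G. \<chi> g) = 0" using sum_group_char[OF \<chi> h] .
  then have "(\<Sum>g\<in>carrier G - {\<one>}. \<chi> g) = - 1"
    using fin \<chi> by (simp add: sum_diff1 group_char_def)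
  then have step: "X i * cnj (T - X i) = - of_nat l" if "i \<in> {1..m}" for i
    using SEDF_char_sum[OF S \<chi> that] that unfolding X_def T_def by (simp add: sum_diff1)
  have r: "X i * cnj T = of_real (r i)" if "i \<in> {1..m}" for i
    using step[OF that] unfolding r_def
    by (simp add: algebra_simps complex_norm_square del: of_real_power)
  have quad: "(r i)^2 = n * r i + real l * n" if "i \<in> {1..m}" for i
  proof -
    have "complex_of_real ((r i)^2) = (X i * cnj T) * cnj (X i * cnj T)"
      unfolding r[OF that] by (simp add: power2_eq_square)
    also have "\<dots> = (X i * cnj (X i)) * (T * cnj T)" by simp
    also have "\<dots> = complex_of_real ((r i + real l) * n)"
      unfolding Tn r_def by (simp add: complex_norm_square del: of_real_power)
    finally have "(r i)^2 = (r i + real l) * n" by (simp only: of_real_eq_iff)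
    then show ?thesis by (simp add: algebra_simps)
  qed
  have "complex_of_real (\<Sum>i\<in>{1..m}. r i) = (\<Sum>i\<in>{1..m}. X i * cnj T)"
    using r by simp
  also have "\<dots> = complex_of_real n" using Tn unfolding T_def by (simp add: sum_distrib_right)
  finally have total: "(\<Sum>i\<in>{1..m}. r i) = n" by (simp only: of_real_eq_iff)
  have "n > 0" unfolding n_def using T by simp
  moreover have "card {1..m} > 2" "real l > 0" "real l \<in> \<rat>" using m l by simp_all
  ultimately obtain i j where ij: "i \<in> {1..m}" "j \<in> {1..m}"
    and *: "r i + real l \<in> \<rat>" "r j + real l \<in> \<rat>" "(r i + real l) * (r j + real l) = (real l)^2"
      "0 < r j + real l" "r j + real l < real l"
    using two_valued_sum[OF finite_atLeastAtMost _ _ _ quad total] by blast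
  have "complex_of_real (r a + real l) = X a * cnj (X a)" for a
    unfolding r_def by (simp add: complex_norm_square del: of_real_power)
  then show ?thesis
    unfolding X_def[symmetric] using ij * by blast
qed

text \<open>The squared modulus of the sum over \<open>E\<close> expands into |E|^2 character values
  of quotients, all roots of unity of order dividing p^2.\<close>

lemma group_char_norm_square_cong:
  fixes G (structure)
  assumes G: "comm_group G" and p: "prime p" and ord: "order G = p ^ 2" and fin: "finite (carrier G)"
    and \<chi>: "group_char G \<chi>" and E: "E \<subseteq> carrier G"
    and A: "A \<in> \<rat>" "complex_of_real A = (\<Sum>x\<in>E. \<chi> x) * cnj (\<Sum>x\<in>E. \<chi> x)"
  shows "\<exists>a::int. A = of_int a \<and> int p dvd a - int (card E)^2"
proof -
  interpret comm_group G by (rule G)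
  define f where "f q = \<chi> (fst q \<otimes> inv (snd q))" for q
  have eq: "complex_of_real A = (\<Sum>q\<in>E \<times> E. f q)"
    unfolding A(2) f_def using E
    by (simp add: sum_product sum.cartesian_product case_prod_unfold)
      (intro sum.cong, auto simp: group_char_div[OF \<chi> fin] subset_iff)
  have "f q ^ (p ^ 2) = 1" if "q \<in> E \<times> E" for q
    unfolding f_def ord[symmetric] using that E
    by (intro group_char_power_order[OF \<chi>]) (auto simp: subset_iff)
  moreover have "(\<Sum>q\<in>E \<times> E. f q) \<in> \<rat>"
    unfolding eq[symmetric] using A(1) by (auto elim!: Rats_cases)
  ultimately obtain a :: int where "(\<Sum>q\<in>E \<times> E. f q) = of_int a" "int p dvd a - int (card (E \<times> E))"
    using rational_sum_roots_of_unity[OF p, of "E \<times> E" f] by blast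
  moreover from this eq have "A = of_int a" by (metis of_real_eq_iff of_real_of_int_eq)
  ultimately show ?thesis by (auto simp: card_cartesian_product power2_eq_square)
qed

theorem theorem32:
  fixes G :: "('a, 'b) monoid_scheme" and p :: nat
  assumes "prime p"
    and "comm_group G"
    and "finite (carrier G)"
    and "order G = p ^ 2"
  shows "\<not> (\<exists>m k l D. m > 2 \<and> k > 1 \<and> SEDF G (p ^ 2) m k l D)"
proof
  assume "\<exists>m k l D. m > 2 \<and> k > 1 \<and> SEDF G (p ^ 2) m k l D"
  then obtain m k l D where m: "m > 2" and k: "k > 1" and S: "SEDF G (p ^ 2) m k l D" by blast
  note p = assms(1) and fin = assms(3) and ord = assms(4)
  interpret comm_group G by (rule assms(2))
  have D: "\<And>i. i \<in> {1..m} \<Longrightarrow> D i \<subseteq> carrier G" "\<And>i. i \<in> {1..m} \<Longrightarrow> card (D i) = k"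
    and disj: "disjoint_family_on D {1..m}" and l: "l \<ge> 1"
    using S unfolding SEDF_def by blast+
  have finD: "finite (D i)" if "i \<in> {1..m}" for i using D(1)[OF that] fin finite_subset by blast
  define E where "E = (\<Union>i\<in>{1..m}. D i)"
  have EG: "E \<subseteq> carrier G" unfolding E_def using D(1) by blast
  have disj': "\<forall>i\<in>{1..m}. \<forall>j\<in>{1..m}. i \<noteq> j \<longrightarrow> D i \<inter> D j = {}"
    using disj unfolding disjoint_family_on_def by blast
  have "card E = (\<Sum>i\<in>{1..m}. card (D i))"
    unfolding E_def using finD disj' by (intro card_UN_disjoint) auto
  then have cardE: "card E = k * m" using D(2) by simp
  have km: "k * m \<le> p ^ 2"
    using card_mono[OF fin EG] cardE ord unfolding Coset.order_def by simp
  \<comment> \<open>The counting identity uses truncated subtraction, which agrees with integer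
    subtraction as m and p^2 are positive.\<close>
  have "int (m - 1) = int m - 1" "int (p^2 - 1) = int p ^ 2 - 1"
    using m prime_gt_0_nat[OF p] by (simp_all add: of_nat_diff Suc_le_eq)
  moreover have "int (k^2 * (m - 1)) = int (l * (p^2 - 1))" using SEDF_count[OF S] m by simp
  ultimately have count: "int k ^ 2 * (int m - 1) = int l * (int p ^ 2 - 1)"
    by (simp only: of_nat_mult of_nat_power)
  have "int (k * m) \<le> int (p ^ 2)" using km by (simp only: of_nat_le_iff)
  then have km': "int k * int m \<le> int p ^ 2" by (simp only: of_nat_mult of_nat_power)
  have pi: "prime (int p)" using p by simp
  have pk: "\<not> p dvd k"
    using SEDF_parameters_bounds(2)[OF pi _ _ _ count km'] k m l by simp
  \<comment> \<open>Otherwise k divides p^2 while being prime to p, which forces k = 1.\<close>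
  have "E \<noteq> carrier G"
  proof
    assume "E = carrier G"
    then have "k * m = p ^ 2" using cardE ord unfolding Coset.order_def by simp
    then have "k dvd p ^ 2" by (metis dvd_triv_left)
    moreover have "coprime k (p ^ 2)" using prime_imp_coprime[OF p pk] by (simp add: coprime_commute)
    ultimately have "is_unit k" using coprime_common_divisor[of k "p ^ 2" k] by simp
    then show False using k by simp
  qed
  moreover have "E \<noteq> {}" using cardE k m by auto
  ultimately obtain \<chi> h where \<chi>: "group_char G \<chi>" and h: "h \<in> carrier G" "\<chi> h \<noteq> 1"
    and nz: "(\<Sum>x\<in>E. \<chi> x) \<noteq> 0"
    using exists_group_char_subset[OF fin EG] by blast
  have "(\<Sum>x\<in>E. \<chi> x) = (\<Sum>i\<in>{1..m}. \<Sum>x\<in>D i. \<chi> x)"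
    unfolding E_def using finD disj' by (intro sum.UNION_disjoint) auto
  then obtain i j A B where ij: "i \<in> {1..m}" "j \<in> {1..m}" and AB: "A \<in> \<rat>" "B \<in> \<rat>"
    "complex_of_real A = (\<Sum>x\<in>D i. \<chi> x) * cnj (\<Sum>x\<in>D i. \<chi> x)"
    "complex_of_real B = (\<Sum>x\<in>D j. \<chi> x) * cnj (\<Sum>x\<in>D j. \<chi> x)"
    and rel: "A * B = (real l)^2" "0 < B" "B < real l"
    using SEDF_char_values[OF S m \<chi> h] nz by metis
  obtain a where a: "A = of_int a" "int p dvd a - int k ^ 2"
    using group_char_norm_square_cong[OF assms(2) p ord fin \<chi> D(1)[OF ij(1)] AB(1,3)] D(2)[OF ij(1)] by auto
  obtain b where b: "B = of_int b" "int p dvd b - int k ^ 2"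
    using group_char_norm_square_cong[OF assms(2) p ord fin \<chi> D(1)[OF ij(2)] AB(2,4)] D(2)[OF ij(2)] by auto
  have "real_of_int (a * b) = real_of_int (int l ^ 2)" using rel(1) a b by simp
  then have "a * b = int l ^ 2" by (simp only: of_int_eq_iff)
  moreover have "0 < b" "b < int l" using rel b by auto
  ultimately show False
    using SEDF_parameters_contradiction[OF pi _ _ _ count km' a(2) b(2)] k m l by simp
qed

end
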